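(* Let $R$ be a unital commutative ring, $\mathcal{R}$ a finitely generated $R$-algebra with generating set $\{t_1,\dots,t_l\}$, $T=\{r_0+\sum_i r_it_i : r_i\in R\}$, $n\ge2$, $I=\{0,\dots,n\}$ and $K_{\{i\}}=\langle e_{j,j+1}(m): j\in I\setminus\{i\}, m\in T\rangle\le\operatorname{EL}_{n+1}(\mathcal{R})$ (indices mod $n+1$). Let $\rho_{cyc}(i)=i+1 \bmod (n+1)$ and $\rho_{rev}(i)=n-i \bmod (n+1)$, let $\gamma_r=\gamma_{\rho_{cyc}}$ and $\gamma_s=\iota\circ\gamma_{\rho_{rev}}$, and let $\Gamma\le\operatorname{Aut}(\operatorname{EL}_{n+1}(\mathcal{R}))$ be the subgroup generated by $\gamma_r,\gamma_s$. Then $\Gamma$ preserves the subgroup geometry system $(K_{\{i\}})_{i\in I}$, and $\Psi(\Gamma)=D_{n+1}$.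
   Context: $e_{i,j}(r)$ is the elementary matrix (rows/columns indexed $0,\dots,n$) with $1$'s on the diagonal, $r$ at $(i,j)$, $0$ elsewhere; $\operatorname{EL}_{n+1}(\mathcal{R})$ is generated by them. For a permutation $\rho$ of $\{0,\dots,n\}$, $\gamma_\rho$ is the automorphism $(\gamma_\rho(A))(i,j)=A(\rho^{-1}(i),\rho^{-1}(j))$ (conjugation by a permutation matrix); $\iota(A)=(A^{-1})^t$. An automorphism $\gamma$ preserves the subgroup geometry system if $\{\gamma(K_{\{i\}}): i\in I\}=\{K_{\{i\}} : i\in I\}$; a group of automorphisms preserves it if each element does. For such $\gamma$, $\psi_\gamma$ is the permutation of $\{0,\dots,n\}$ with $\gamma(K_{\{i\}})=K_{\{\psi_\gamma(i)\}}$, and $\Psi(\gamma)=\psi_\gamma$. $D_{n+1}$ is the dihedral group, realized as the set of permutations $\rho$ of $\{0,\dots,n\}$ such that $(i-j)\bmod(n+1)=\pm1$ iff $(\rho(i)-\rho(j))\bmod(n+1)=\pm1$.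
   Formalization: The R-algebra is taken to be commutative (and nonzero): for n ≥ 2 the map γ_s, built from inverse transpose, is an automorphism only over a commutative algebra, so Γ ≤ Aut(EL) is undefined otherwise. *)

theory Defs
  imports
    "HOL-Algebra.Bij"
    "HOL-Algebra.Generated_Groups"
    "HOL-Combinatorics.Permutations"
    "HOL-Number_Theory.Cong"
    "HOL.Hull"
    "Jordan_Normal_Form.Gauss_Jordan_Elimination"
begin

locale assoc_algebra = Modules.module scale
  for scale :: "'r::comm_ring_1 \<Rightarrow> 'a::ring_1 \<Rightarrow> 'a" +
  assumes scale_mult_left: "scale r x * y = scale r (x * y)"
    and scale_mult_right: "x * scale r y = scale r (x * y)"

definition unital_subalgebra :: "('r::comm_ring_1 \<Rightarrow> 'a::ring_1 \<Rightarrow> 'a) \<Rightarrow> 'a set \<Rightarrow> bool" where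
  "unital_subalgebra scale S \<longleftrightarrow>
     1 \<in> S \<and> (\<forall>x\<in>S. \<forall>y\<in>S. x + y \<in> S \<and> x * y \<in> S) \<and> (\<forall>r. \<forall>x\<in>S. scale r x \<in> S)"

definition algebra_generating_set :: "('r::comm_ring_1 \<Rightarrow> 'a::ring_1 \<Rightarrow> 'a) \<Rightarrow> 'a set \<Rightarrow> bool" where
  "algebra_generating_set scale S \<longleftrightarrow> unital_subalgebra scale hull S = UNIV"

text \<open>The summand \<open>r 0\<close> is embedded in the algebra as \<open>scale (r 0) 1\<close>.\<close>

definition affine_span ::
    "('r::comm_ring_1 \<Rightarrow> 'a::ring_1 \<Rightarrow> 'a) \<Rightarrow> (nat \<Rightarrow> 'a) \<Rightarrow> nat \<Rightarrow> 'a set" where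
  "affine_span scale t l = {scale (r 0) 1 + (\<Sum>i=1..l. scale (r i) (t i)) | r. True}"

text \<open>Matrix rows and columns are indexed from \<open>0\<close>, and all matrices below have size \<open>n + 1\<close>.
  For \<open>i \<noteq> j\<close>, \<open>addrow_mat (n + 1) r i j\<close> is the elementary matrix with entry \<open>r\<close> at \<open>(i, j)\<close>.\<close>

abbreviation elem_mat :: "nat \<Rightarrow> nat \<Rightarrow> nat \<Rightarrow> 'a::ring_1 \<Rightarrow> 'a mat" where
  "elem_mat n i j r \<equiv> addrow_mat (n + 1) r i j"

definition GL_group :: "nat \<Rightarrow> 'a::ring_1 mat monoid" where
  "GL_group n = units_of (ring_mat TYPE('a) (n + 1) ())"

definition EL_group :: "nat \<Rightarrow> 'a::ring_1 mat monoid" where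
  "EL_group n = (GL_group n)\<lparr>carrier :=
     generate (GL_group n) {elem_mat n i j r | i j r. i \<le> n \<and> j \<le> n \<and> i \<noteq> j}\<rparr>"

definition K_subgroup :: "nat \<Rightarrow> 'a::ring_1 set \<Rightarrow> nat \<Rightarrow> 'a mat set" where
  "K_subgroup n T i = generate (EL_group n)
     {elem_mat n j ((j + 1) mod (n + 1)) m | j m. j \<in> {0..n} - {i} \<and> m \<in> T}"

text \<open>As required by \<^const>\<open>auto\<close>, automorphisms are made extensional, i.e. restricted to the
  carrier of \<^const>\<open>EL_group\<close>.\<close>

definition perm_aut :: "nat \<Rightarrow> (nat \<Rightarrow> nat) \<Rightarrow> 'a::ring_1 mat \<Rightarrow> 'a mat" where
  "perm_aut n \<rho> = (\<lambda>A \<in> carrier (EL_group n). mat (n + 1) (n + 1)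
     (\<lambda>(i, j). A $$ (inv_into {0..n} \<rho> i, inv_into {0..n} \<rho> j)))"

definition inverse_transpose :: "nat \<Rightarrow> 'a::ring_1 mat \<Rightarrow> 'a mat" where
  "inverse_transpose n = (\<lambda>A \<in> carrier (EL_group n). transpose_mat (inv\<^bsub>EL_group n\<^esub> A))"

definition rho_cyc :: "nat \<Rightarrow> nat \<Rightarrow> nat" where
  "rho_cyc n i = (i + 1) mod (n + 1)"

definition rho_rev :: "nat \<Rightarrow> nat \<Rightarrow> nat" where
  "rho_rev n i = (n - i) mod (n + 1)"

definition gamma_r :: "nat \<Rightarrow> 'a::ring_1 mat \<Rightarrow> 'a mat" where
  "gamma_r n = perm_aut n (rho_cyc n)"

definition gamma_s :: "nat \<Rightarrow> 'a::ring_1 mat \<Rightarrow> 'a mat" where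
  "gamma_s n = compose (carrier (EL_group n)) (inverse_transpose n) (perm_aut n (rho_rev n))"

definition Gamma :: "nat \<Rightarrow> ('a::ring_1 mat \<Rightarrow> 'a mat) set" where
  "Gamma n = generate (AutoGroup (EL_group n)) {gamma_r n, gamma_s n}"

definition preserves_system :: "nat \<Rightarrow> 'a::ring_1 set \<Rightarrow> ('a mat \<Rightarrow> 'a mat) \<Rightarrow> bool" where
  "preserves_system n T \<gamma> \<longleftrightarrow>
     {\<gamma> ` K_subgroup n T i | i. i \<in> {0..n}} = {K_subgroup n T i | i. i \<in> {0..n}}"

definition Psi :: "nat \<Rightarrow> 'a::ring_1 set \<Rightarrow> ('a mat \<Rightarrow> 'a mat) \<Rightarrow> nat \<Rightarrow> nat" where
  "Psi n T \<gamma> = (THE \<psi>. \<psi> permutes {0..n} \<and>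
     (\<forall>i\<in>{0..n}. \<gamma> ` K_subgroup n T i = K_subgroup n T (\<psi> i)))"

definition cyc_adjacent :: "nat \<Rightarrow> nat \<Rightarrow> nat \<Rightarrow> bool" where
  "cyc_adjacent n i j \<longleftrightarrow>
     [int i - int j = 1] (mod int (n + 1)) \<or> [int i - int j = - 1] (mod int (n + 1))"

definition dihedral :: "nat \<Rightarrow> (nat \<Rightarrow> nat) set" where
  "dihedral n = {\<rho>. \<rho> permutes {0..n} \<and>
     (\<forall>i\<in>{0..n}. \<forall>j\<in>{0..n}. cyc_adjacent n i j \<longleftrightarrow> cyc_adjacent n (\<rho> i) (\<rho> j))}"

text \<open>The definitions make sense over any unital ring, but inverse transpose reverses the order of
  the products of ring elements: for \<open>n \<ge> 2\<close>, \<^const>\<open>gamma_s\<close> can be an automorphism only if the ring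
  is commutative. The lemma \<open>gamma_s_auto_imp_commute\<close> below proves this; hence a statement about
  the subgroup generated by \<^const>\<open>gamma_s\<close> in the automorphism group is one about commutative
  algebras.\<close>

lemma elem_mat_mult_index:
  assumes "X \<in> carrier_mat (n + 1) (n + 1)" "j \<le> n" "a \<le> n" "b \<le> n"
  shows "(elem_mat n i j r * X) $$ (a, b) = (if i = a then r * X $$ (j, b) + X $$ (a, b) else X $$ (a, b))"
  using assms by (subst addrow_mat[symmetric, OF assms(1)]) auto

lemmas elem_mat_mult_index_Suc = elem_mat_mult_index[unfolded Suc_eq_plus1[symmetric]]

lemma elem_mat_inv:
  fixes r :: "'a::ring_1"
  assumes "i \<le> n" "j \<le> n" "i \<noteq> j"
  shows "elem_mat n i j r * elem_mat n i j (- r) = 1\<^sub>m (n + 1)"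
  by (rule eq_matI) (use assms in \<open>auto simp: elem_mat_mult_index_Suc simp del: index_mult_mat(1)\<close>)

lemma elem_mat_Units:
  fixes r :: "'a::ring_1"
  assumes "i \<le> n" "j \<le> n" "i \<noteq> j"
  shows "elem_mat n i j r \<in> Units (ring_mat TYPE('a) (n + 1) ())"
  using elem_mat_inv[OF assms, of r] elem_mat_inv[OF assms, of "- r"]
  by (auto simp: Units_def ring_mat_def intro!: bexI[of _ "elem_mat n i j (- r)"])

lemma group_GL: "group (GL_group n :: 'a::ring_1 mat monoid)"
proof -
  interpret semiring "ring_mat TYPE('a) (n + 1) ()" by (rule semiring_mat)
  show ?thesis unfolding GL_group_def by (rule units_group)
qed

lemma subgroup_EL: "subgroup (carrier (EL_group n :: 'a::ring_1 mat monoid)) (GL_group n)"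
proof -
  have "{elem_mat n i j (r::'a) | i j r. i \<le> n \<and> j \<le> n \<and> i \<noteq> j} \<subseteq> carrier (GL_group n)"
    unfolding GL_group_def units_of_carrier using elem_mat_Units by blast
  from group.generate_is_subgroup[OF group_GL this] show ?thesis by (simp add: EL_group_def)
qed

lemma EL_simps:
  "Group.monoid.mult (EL_group n) = ((*) :: 'a::ring_1 mat \<Rightarrow> _)"
  "one (EL_group n) = (1\<^sub>m (n + 1) :: 'a::ring_1 mat)"
  by (simp_all add: EL_group_def GL_group_def units_of_def ring_mat_def)

lemma group_EL: "group (EL_group n :: 'a::ring_1 mat monoid)"
proof -
  have "EL_group n = (GL_group n)\<lparr>carrier := carrier (EL_group n :: 'a::ring_1 mat monoid)\<rparr>"
    by (simp add: EL_group_def)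
  then show ?thesis using subgroup.subgroup_is_group[OF subgroup_EL group_GL] by metis
qed

lemma elem_mat_in_EL:
  "i \<le> n \<Longrightarrow> j \<le> n \<Longrightarrow> i \<noteq> j \<Longrightarrow> elem_mat n i j (r::'a::ring_1) \<in> carrier (EL_group n)"
  unfolding EL_group_def by (auto intro: generate.incl)

lemma EL_carrier_mat: "A \<in> carrier (EL_group n) \<Longrightarrow> (A::'a::ring_1 mat) \<in> carrier_mat (n + 1) (n + 1)"
  using subgroup.subset[OF subgroup_EL, of n]
  by (auto simp: GL_group_def units_of_def Units_def ring_mat_def)

lemma inv_into_rho_rev: assumes "i \<le> n" shows "inv_into {0..n} (rho_rev n) i = n - i"
  by (rule inv_into_f_eq) (use assms in \<open>auto simp: rho_rev_def inj_on_def\<close>)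

lemma EL_mult_closed: "A \<in> carrier (EL_group n) \<Longrightarrow> B \<in> carrier (EL_group n) \<Longrightarrow> A * B \<in> carrier (EL_group n :: 'a::ring_1 mat monoid)"
  using monoid.m_closed[OF group.is_monoid[OF group_EL]] by (simp add: EL_simps)

lemma gamma_s_eval:
  fixes A X Y :: "'a::ring_1 mat"
  assumes A: "A \<in> carrier (EL_group n)" and X: "X \<in> carrier (EL_group n)" 
    and Y: "Y \<in> carrier (EL_group n)" 
    and AX: "\<And>i j. i \<le> n \<Longrightarrow> j \<le> n \<Longrightarrow> A $$ (n - i, n - j) = X $$ (i, j)"
    and XY: "X * Y = 1\<^sub>m (n + 1)"
  shows "gamma_s n A = transpose_mat Y"
proof -
  interpret group "EL_group n :: 'a mat monoid" by (rule group_EL)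
  have "perm_aut n (rho_rev n) A = X"
    using A EL_carrier_mat[OF X] by (auto simp: perm_aut_def inv_into_rho_rev AX intro!: eq_matI)
  moreover have "inv\<^bsub>EL_group n\<^esub> X = Y"
    by (metis X Y XY EL_simps(1,2) inv_equality inv_inv)
  ultimately show ?thesis
    using A X by (simp add: gamma_s_def compose_def inverse_transpose_def)
qed


lemma diff_left_cancel_nat: "i \<le> n \<Longrightarrow> a \<le> n \<Longrightarrow> (n - a = n - i) = (a = (i::nat))" by auto

lemma elem_mat_rev_index: 
  assumes "a \<le> n" "b \<le> n" "i \<le> n" "j \<le> n"
  shows "elem_mat n (n - a) (n - b) (r::'a::ring_1) $$ (n - i, n - j) = elem_mat n a b r $$ (i, j)"
proof -
  have "n - i < n + 1" "n - j < n + 1" "i < n + 1" "j < n + 1" using assms by auto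
  then show ?thesis using assms by (simp only: index_mat_addrow_mat diff_left_cancel_nat)
qed

lemma elem_mat_mult_rev_index:
  assumes "a \<le> n" "b \<le> n" "c \<le> n" "d \<le> n" "i \<le> n" "j \<le> n"
  shows "(elem_mat n (n - a) (n - b) (r::'a::ring_1) * elem_mat n (n - c) (n - d) s) $$ (n - i, n - j)
    = (elem_mat n a b r * elem_mat n c d s) $$ (i, j)"
  using assms by (simp only: elem_mat_mult_index addrow_mat_carrier diff_le_self diff_left_cancel_nat elem_mat_rev_index)

lemma gamma_s_auto_imp_commute:
  fixes x y :: "'a::ring_1"
  assumes n: "n \<ge> 2" and g: "gamma_s n \<in> auto (EL_group n :: 'a mat monoid)"
  shows "x * y = y * x"
proof -
  let ?E = "elem_mat n :: nat \<Rightarrow> nat \<Rightarrow> 'a \<Rightarrow> 'a mat"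
  define A B where "A = ?E n (n - 1) x" and "B = ?E (n - 1) (n - 2) y"
  have E: "\<And>i j r. i \<le> n \<Longrightarrow> j \<le> n \<Longrightarrow> i \<noteq> j \<Longrightarrow> ?E i j r \<in> carrier (EL_group n)"
    by (rule elem_mat_in_EL)
  have A: "A \<in> carrier (EL_group n)" and B: "B \<in> carrier (EL_group n)"
    unfolding A_def B_def by (rule E; use n in simp)+
  have A': "A = ?E (n - 0) (n - 1) x" and B': "B = ?E (n - 1) (n - 2) y" by (simp_all add: A_def B_def)
  have le: "0 \<le> n" "1 \<le> n" "2 \<le> n" "0 \<noteq> (1::nat)" "1 \<noteq> (2::nat)" using n by auto
  have gA: "gamma_s n A = transpose_mat (?E 0 1 (- x))"
    by (rule gamma_s_eval[OF A E E _ elem_mat_inv]) (use le in \<open>auto simp: A' elem_mat_rev_index simp del: One_nat_def\<close>)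
  have gB: "gamma_s n B = transpose_mat (?E 1 2 (- y))"
  proof (rule gamma_s_eval[OF B, of "?E 1 2 y"])
    show "?E 1 2 y \<in> carrier (EL_group n)" "?E 1 2 (- y) \<in> carrier (EL_group n)" by (rule E; use le in simp)+
    show "?E 1 2 y * ?E 1 2 (- y) = 1\<^sub>m (n + 1)" by (rule elem_mat_inv; use le in simp)
    show "B $$ (n - i, n - j) = ?E 1 2 y $$ (i, j)" if "i \<le> n" "j \<le> n" for i j
      unfolding B' by (rule elem_mat_rev_index[OF le(2,3) that])
  qed
  have gBA: "gamma_s n (B * A) = transpose_mat (?E 0 1 (- x) * ?E 1 2 (- y))"
  proof (rule gamma_s_eval[of _ _ "?E 1 2 y * ?E 0 1 x"])
    show "?E 1 2 y * ?E 0 1 x * (?E 0 1 (- x) * ?E 1 2 (- y)) = 1\<^sub>m (n + 1)" (is "?l = _")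
    proof -
      have "?l = ?E 1 2 y * ((?E 0 1 x * ?E 0 1 (- x)) * ?E 1 2 (- y))"
      proof -
        have "?l = ?E 1 2 y * (?E 0 1 x * (?E 0 1 (- x) * ?E 1 2 (- y)))"
          by (rule assoc_mult_mat[of _ "n+1" "n+1" _ "n+1" _ "n+1"]) (rule addrow_mat_carrier mult_carrier_mat)+
        also have "?E 0 1 x * (?E 0 1 (- x) * ?E 1 2 (- y)) = (?E 0 1 x * ?E 0 1 (- x)) * ?E 1 2 (- y)"
          by (rule assoc_mult_mat[symmetric, of _ "n+1" "n+1" _ "n+1" _ "n+1"]) (rule addrow_mat_carrier)+
        finally show ?thesis .
      qed
      also have "?E 0 1 x * ?E 0 1 (- x) = 1\<^sub>m (n + 1)" by (rule elem_mat_inv; use le in simp)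
      also have "1\<^sub>m (n + 1) * ?E 1 2 (- y) = ?E 1 2 (- y)" by (rule left_mult_one_mat[OF addrow_mat_carrier])
      also have "?E 1 2 y * ?E 1 2 (- y) = 1\<^sub>m (n + 1)" by (rule elem_mat_inv; use le in simp)
      finally show ?thesis .
    qed
    show "(B * A) $$ (n - i, n - j) = (?E 1 2 y * ?E 0 1 x) $$ (i, j)" if "i \<le> n" "j \<le> n" for i j
      unfolding A' B' by (rule elem_mat_mult_rev_index[OF le(2,3,1,2) that])
    show "B * A \<in> carrier (EL_group n)" by (rule EL_mult_closed[OF B A])
    show "?E 1 2 y * ?E 0 1 x \<in> carrier (EL_group n)"
      by (rule EL_mult_closed; rule E; use le in simp)
    show "?E 0 1 (- x) * ?E 1 2 (- y) \<in> carrier (EL_group n)"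
      by (rule EL_mult_closed; rule E; use le in simp)
  qed
  have "gamma_s n (B * A) = gamma_s n B * gamma_s n A"
    using g A B by (auto simp: auto_def hom_def EL_simps)
  then have eq: "transpose_mat (?E 0 1 (- x) * ?E 1 2 (- y)) = transpose_mat (?E 1 2 (- y)) * transpose_mat (?E 0 1 (- x))"
    by (simp only: gA gB gBA)
  have t: "transpose_mat (?E 1 2 (- y)) = ?E 2 1 (- y)" "transpose_mat (?E 0 1 (- x)) = ?E 1 0 (- x)"
    by (rule eq_matI; force)+
  have "(?E 0 1 (- x) * ?E 1 2 (- y)) $$ (0, 2) = transpose_mat (?E 0 1 (- x) * ?E 1 2 (- y)) $$ (2, 0)"
    using n by (subst index_transpose_mat(1)) simp_all
  also have "\<dots> = (?E 2 1 (- y) * ?E 1 0 (- x)) $$ (2, 0)" by (simp only: eq t)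
  also have "\<dots> = y * x" using n by (subst elem_mat_mult_index) simp_all
  also have "(?E 0 1 (- x) * ?E 1 2 (- y)) $$ (0, 2) = x * y" using n by (subst elem_mat_mult_index) simp_all
  finally show ?thesis .
qed

end

(*
  A permutation matrix relabels elementary generators, and inverse transpose reverses their indices.
  Hence gamma_r sends K_i to K_(i+1), while gamma_s sends e_(j,j+1)(m) to e_(j',j'+1)(-m) with
  j' = n - 1 - j modulo n + 1; since T = -T, it sends K_i to K_(i').
  The groups K_i are pairwise distinct, because every matrix in K_i has the i-th row of the identity
  matrix, whereas e_(i,i+1)(1) lies in all the others. So the image of Psi is generated by a
  rotation and a reflection of the (n+1)-cycle, and an automorphism of a cycle of length at least 3
  is determined by its value at one vertex and the direction in which it runs around the cycle.
*)
theory Submission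
  imports Defs
begin

section \<open>Automorphisms of the elementary group\<close>

lemma EL_inv_elem_mat:
  fixes r :: "'a::ring_1"
  assumes "i \<le> n" "j \<le> n" "i \<noteq> j"
  shows "inv\<^bsub>EL_group n\<^esub> (elem_mat n i j r) = elem_mat n i j (- r)"
proof -
  interpret group "EL_group n :: 'a mat monoid" by (rule group_EL)
  show ?thesis
    using elem_mat_inv[OF assms, of "- r"] elem_mat_in_EL[OF assms]
    by (intro inv_equality) (simp_all only: EL_simps minus_minus)
qed

text \<open>The carrier of \<open>EL_group\<close> is generated inside \<open>GL_group\<close>, so
  the \<open>inv\<close> case of an induction over it speaks of inverses in
  \<open>GL_group\<close>.\<close>

lemma GL_inv_elem_mat:
  fixes r :: "'a::ring_1"
  assumes "i \<le> n" "j \<le> n" "i \<noteq> j"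
  shows "inv\<^bsub>GL_group n\<^esub> (elem_mat n i j r) = elem_mat n i j (- r)"
proof -
  interpret group "GL_group n :: 'a mat monoid" by (rule group_GL)
  have GL: "elem_mat n i j s \<in> carrier (GL_group n)" for s :: 'a
    using elem_mat_Units[OF assms] by (simp add: GL_group_def units_of_carrier)
  show ?thesis
    using elem_mat_inv[OF assms, of "- r"] GL
    by (intro inv_equality) (simp_all add: GL_group_def units_of_def ring_mat_def)
qed

text \<open>No case for inverses arises: the inverse of an elementary matrix is elementary, so
  products alone exhaust the group.\<close>

lemma EL_induct [consumes 1, case_names one elem mult]:
  fixes A :: "'a::ring_1 mat"
  assumes "A \<in> carrier (EL_group n)"
    and one: "P (1\<^sub>m (n + 1))"
    and elem: "\<And>i j r. i \<le> n \<Longrightarrow> j \<le> n \<Longrightarrow> i \<noteq> j \<Longrightarrow> P (elem_mat n i j r)"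
    and mult: "\<And>A B. A \<in> carrier (EL_group n) \<Longrightarrow> B \<in> carrier (EL_group n) \<Longrightarrow>
      P A \<Longrightarrow> P B \<Longrightarrow> P (A * B)"
  shows "P A"
proof -
  have "A \<in> generate (GL_group n) {elem_mat n i j r | i j r. i \<le> n \<and> j \<le> n \<and> i \<noteq> j}"
    using assms(1) by (simp add: EL_group_def)
  then show ?thesis
  proof (induction rule: generate.induct)
    case one
    then show ?case using assms(2) by (simp add: GL_group_def units_of_def ring_mat_def)
  next
    case (incl h)
    then show ?case using elem by auto
  next
    case (inv h)
    then obtain i j r where h: "h = elem_mat n i j r" "i \<le> n" "j \<le> n" "i \<noteq> j" by blast
    show ?case unfolding h(1) GL_inv_elem_mat[OF h(2-4)] by (rule elem[OF h(2-4)])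
  next
    case (eng h1 h2)
    then have "h1 \<in> carrier (EL_group n)" "h2 \<in> carrier (EL_group n)"
      by (simp_all add: EL_group_def)
    from mult[OF this eng.IH] show ?case by (simp add: GL_group_def units_of_def ring_mat_def)
  qed
qed

lemma one_in_EL: "1\<^sub>m (n + 1) \<in> carrier (EL_group n :: 'a::ring_1 mat monoid)"
  using monoid.one_closed[OF group.is_monoid[OF group_EL]] by (metis EL_simps(2))

text \<open>Closedness and surjectivity are asked for on elementary matrices only, since a
  multiplicative map carries both over to products.\<close>

lemma EL_autoI:
  fixes h :: "'a::ring_1 mat \<Rightarrow> 'a mat"
  assumes ext: "h \<in> extensional (carrier (EL_group n))"
    and inj: "inj_on h (carrier (EL_group n))"
    and mult: "\<And>A B. A \<in> carrier (EL_group n) \<Longrightarrow> B \<in> carrier (EL_group n) \<Longrightarrow> h (A * B) = h A * h B"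
    and one: "h (1\<^sub>m (n + 1)) = 1\<^sub>m (n + 1)"
    and elem: "\<And>i j r. i \<le> n \<Longrightarrow> j \<le> n \<Longrightarrow> i \<noteq> j \<Longrightarrow> h (elem_mat n i j r) \<in> carrier (EL_group n)"
    and surj: "\<And>i j r. i \<le> n \<Longrightarrow> j \<le> n \<Longrightarrow> i \<noteq> j \<Longrightarrow> elem_mat n i j r \<in> h ` carrier (EL_group n)"
  shows "h \<in> auto (EL_group n)"
proof -
  let ?C = "carrier (EL_group n) :: 'a mat set"
  have closed: "h A \<in> ?C" if "A \<in> ?C" for A
    using that
  proof (induction rule: EL_induct)
    case one
    then show ?case using one_in_EL by (simp only: assms(4))
  next
    case (elem i j r)
    then show ?case by (rule assms(5))
  next
    case (mult A B)
    then show ?case using assms(3) EL_mult_closed by metis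
  qed
  have onto: "A \<in> h ` ?C" if "A \<in> ?C" for A
    using that
  proof (induction rule: EL_induct)
    case one
    then show ?case using one_in_EL assms(4) by (metis image_eqI)
  next
    case (elem i j r)
    then show ?case by (rule surj)
  next
    case (mult A B)
    then obtain A' B' where "A' \<in> ?C" "B' \<in> ?C" "A = h A'" "B = h B'" by blast
    then show ?case using assms(3)[of A' B'] EL_mult_closed[of A' n B'] by (metis image_eqI)
  qed
  have "bij_betw h ?C ?C" using inj closed onto by (auto simp: bij_betw_def)
  then show ?thesis using ext closed mult by (auto simp: auto_def Bij_def hom_def EL_simps)
qed

lemma EL_mult_index:
  fixes A B :: "'a::ring_1 mat"
  assumes "A \<in> carrier (EL_group n)" "B \<in> carrier (EL_group n)" "a \<le> n" "b \<le> n"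
  shows "(A * B) $$ (a, b) = (\<Sum>k\<in>{0..n}. A $$ (a, k) * B $$ (k, b))"
  using EL_carrier_mat[OF assms(1)] EL_carrier_mat[OF assms(2)] assms(3,4)
  by (simp add: scalar_prod_def atLeastLessThanSuc_atLeastAtMost)

lemma elem_mat_index:
  "a \<le> n \<Longrightarrow> b \<le> n \<Longrightarrow>
    elem_mat n i j (r::'a::ring_1) $$ (a, b) = (if i = a \<and> j = b then r else 0) + (if a = b then 1 else 0)"
  by simp

lemma square_mat_eqI:
  fixes A B :: "'a::ring_1 mat"
  assumes "A \<in> carrier_mat (n + 1) (n + 1)" "B \<in> carrier_mat (n + 1) (n + 1)"
    and "\<And>a b. a \<le> n \<Longrightarrow> b \<le> n \<Longrightarrow> A $$ (a, b) = B $$ (a, b)"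
  shows "A = B"
  using assms by (intro eq_matI) auto

section \<open>Conjugation by a permutation matrix\<close>

context
  fixes n :: nat and \<rho> :: "nat \<Rightarrow> nat"
  assumes \<rho>: "bij_betw \<rho> {0..n} {0..n}"
begin

lemma bij_betw_inv_rho: "bij_betw (inv_into {0..n} \<rho>) {0..n} {0..n}"
  by (rule bij_betw_inv_into[OF \<rho>])

lemma inv_rho_le: "a \<le> n \<Longrightarrow> inv_into {0..n} \<rho> a \<le> n"
  using bij_betw_apply[OF bij_betw_inv_rho, of a] by simp

lemma rho_le: "a \<le> n \<Longrightarrow> \<rho> a \<le> n"
  using bij_betw_apply[OF \<rho>, of a] by simp

lemma inv_rho_eq_iff: "a \<le> n \<Longrightarrow> i \<le> n \<Longrightarrow> inv_into {0..n} \<rho> a = i \<longleftrightarrow> a = \<rho> i"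
  using bij_betw_inv_into_left[OF \<rho>, of i] bij_betw_inv_into_right[OF \<rho>, of a] by auto

lemma inv_rho_inj: "a \<le> n \<Longrightarrow> b \<le> n \<Longrightarrow> inv_into {0..n} \<rho> a = inv_into {0..n} \<rho> b \<longleftrightarrow> a = b"
  using bij_betw_imp_inj_on[OF bij_betw_inv_rho] by (auto simp: inj_on_def)

lemma perm_aut_carrier_mat:
  "(A::'a::ring_1 mat) \<in> carrier (EL_group n) \<Longrightarrow> perm_aut n \<rho> A \<in> carrier_mat (n + 1) (n + 1)"
  by (simp add: perm_aut_def)

lemma perm_aut_index:
  "(A::'a::ring_1 mat) \<in> carrier (EL_group n) \<Longrightarrow> a \<le> n \<Longrightarrow> b \<le> n \<Longrightarrow>
    perm_aut n \<rho> A $$ (a, b) = A $$ (inv_into {0..n} \<rho> a, inv_into {0..n} \<rho> b)"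
  by (simp add: perm_aut_def)

text \<open>The image is read at (a, b) by looking up the preimages of a and b, so the special
  position (i, j) reappears at (\<open>\<rho> i\<close>, \<open>\<rho> j\<close>).\<close>

lemma perm_aut_elem_mat:
  fixes r :: "'a::ring_1"
  assumes "i \<le> n" "j \<le> n" "i \<noteq> j"
  shows "perm_aut n \<rho> (elem_mat n i j r) = elem_mat n (\<rho> i) (\<rho> j) r"
proof (rule square_mat_eqI)
  fix a b assume ab: "a \<le> n" "b \<le> n"
  have "i = inv_into {0..n} \<rho> a \<longleftrightarrow> \<rho> i = a" "j = inv_into {0..n} \<rho> b \<longleftrightarrow> \<rho> j = b"
    using inv_rho_eq_iff ab assms by metis+
  then show "perm_aut n \<rho> (elem_mat n i j r) $$ (a, b) = elem_mat n (\<rho> i) (\<rho> j) r $$ (a, b)"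
    using ab assms
    by (simp only: perm_aut_index[OF elem_mat_in_EL[OF assms]] elem_mat_index inv_rho_le inv_rho_inj)
qed (rule perm_aut_carrier_mat elem_mat_in_EL assms addrow_mat_carrier)+

lemma perm_aut_mult:
  fixes A B :: "'a::ring_1 mat"
  assumes A: "A \<in> carrier (EL_group n)" and B: "B \<in> carrier (EL_group n)"
  shows "perm_aut n \<rho> (A * B) = perm_aut n \<rho> A * perm_aut n \<rho> B"
proof (rule square_mat_eqI)
  let ?\<sigma> = "inv_into {0..n} \<rho>"
  fix a b assume ab: "a \<le> n" "b \<le> n"
  have "perm_aut n \<rho> (A * B) $$ (a, b) = (A * B) $$ (?\<sigma> a, ?\<sigma> b)"
    using ab by (intro perm_aut_index EL_mult_closed A B)
  also have "\<dots> = (\<Sum>k\<in>{0..n}. A $$ (?\<sigma> a, k) * B $$ (k, ?\<sigma> b))"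
    using ab by (intro EL_mult_index A B inv_rho_le)
  \<comment> \<open>Substituting \<open>?\<sigma> k\<close> for the summation index makes both
    factors entries of permuted matrices.\<close>
  also have "\<dots> = (\<Sum>k\<in>{0..n}. A $$ (?\<sigma> a, ?\<sigma> k) * B $$ (?\<sigma> k, ?\<sigma> b))"
    by (rule sum.reindex_bij_betw[OF bij_betw_inv_rho, symmetric])
  also have "\<dots> = (\<Sum>k\<in>{0..n}. perm_aut n \<rho> A $$ (a, k) * perm_aut n \<rho> B $$ (k, b))"
    using ab by (intro sum.cong) (simp_all add: perm_aut_index A B)
  also have "\<dots> = (perm_aut n \<rho> A * perm_aut n \<rho> B) $$ (a, b)"
    using perm_aut_carrier_mat[OF A] perm_aut_carrier_mat[OF B] ab
    by (simp add: scalar_prod_def atLeastLessThanSuc_atLeastAtMost)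
  finally show "perm_aut n \<rho> (A * B) $$ (a, b) = (perm_aut n \<rho> A * perm_aut n \<rho> B) $$ (a, b)" .
qed (rule perm_aut_carrier_mat mult_carrier_mat EL_mult_closed A B)+

lemma perm_aut_in_auto: "perm_aut n \<rho> \<in> auto (EL_group n :: 'a::ring_1 mat monoid)"
proof (rule EL_autoI)
  let ?\<sigma> = "inv_into {0..n} \<rho>"
  show "perm_aut n \<rho> \<in> extensional (carrier (EL_group n :: 'a mat monoid))"
    by (simp add: perm_aut_def)
  show "inj_on (perm_aut n \<rho>) (carrier (EL_group n :: 'a mat monoid))"
  proof (rule inj_onI)
    fix A B :: "'a mat"
    assume A: "A \<in> carrier (EL_group n)" and B: "B \<in> carrier (EL_group n)"
      and eq: "perm_aut n \<rho> A = perm_aut n \<rho> B"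
    show "A = B"
    proof (rule square_mat_eqI[OF EL_carrier_mat[OF A] EL_carrier_mat[OF B]])
      \<comment> \<open>The entry of \<open>A\<close> at (a, b) survives in the image at
        (\<open>\<rho> a\<close>, \<open>\<rho> b\<close>), so the image determines
        \<open>A\<close>.\<close>
      fix a b assume ab: "a \<le> n" "b \<le> n"
      then have "?\<sigma> (\<rho> a) = a" "?\<sigma> (\<rho> b) = b"
        using inv_rho_eq_iff rho_le by blast+
      then show "A $$ (a, b) = B $$ (a, b)"
        using perm_aut_index[OF A, of "\<rho> a" "\<rho> b"] perm_aut_index[OF B, of "\<rho> a" "\<rho> b"] ab rho_le eq
        by metis
    qed
  qed
  show "perm_aut n \<rho> (A * B) = perm_aut n \<rho> A * perm_aut n \<rho> B"
    if "A \<in> carrier (EL_group n)" "B \<in> carrier (EL_group n)" for A B :: "'a mat"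
    by (rule perm_aut_mult[OF that])
  show "perm_aut n \<rho> (1\<^sub>m (n + 1)) = (1\<^sub>m (n + 1) :: 'a mat)"
  proof (rule square_mat_eqI)
    fix a b assume "a \<le> n" "b \<le> n"
    then show "perm_aut n \<rho> (1\<^sub>m (n + 1)) $$ (a, b) = (1\<^sub>m (n + 1) :: 'a mat) $$ (a, b)"
      using inv_rho_le[of a] inv_rho_le[of b]
      by (simp only: perm_aut_index[OF one_in_EL]) (simp add: inv_rho_inj)
  qed (rule perm_aut_carrier_mat one_in_EL one_carrier_mat)+
  have inj: "\<rho> i \<noteq> \<rho> j" if "i \<le> n" "j \<le> n" "i \<noteq> j" for i j
    using that bij_betw_imp_inj_on[OF \<rho>] by (auto simp: inj_on_def)
  show "perm_aut n \<rho> (elem_mat n i j r) \<in> carrier (EL_group n)"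
    if "i \<le> n" "j \<le> n" "i \<noteq> j" for i j and r :: 'a
    unfolding perm_aut_elem_mat[OF that] using that by (intro elem_mat_in_EL rho_le inj)
  show "elem_mat n i j r \<in> perm_aut n \<rho> ` carrier (EL_group n)"
    if "i \<le> n" "j \<le> n" "i \<noteq> j" for i j and r :: 'a
  proof (rule image_eqI)
    \<comment> \<open>The preimage is the elementary matrix with both indices pulled back along
      \<open>\<rho>\<close>.\<close>
    have ne: "?\<sigma> i \<noteq> ?\<sigma> j" using that inv_rho_inj by blast
    have "\<rho> (?\<sigma> i) = i" "\<rho> (?\<sigma> j) = j"
      using that bij_betw_inv_into_right[OF \<rho>] by auto
    then show "elem_mat n i j r = perm_aut n \<rho> (elem_mat n (?\<sigma> i) (?\<sigma> j) r)"
      using perm_aut_elem_mat[OF inv_rho_le inv_rho_le ne, of r] that by simp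
    show "elem_mat n (?\<sigma> i) (?\<sigma> j) r \<in> carrier (EL_group n)"
      using that ne by (intro elem_mat_in_EL inv_rho_le)
  qed
qed

end

section \<open>The inverse transpose\<close>

lemma transpose_elem_mat:
  assumes "i \<le> n" "j \<le> n" "i \<noteq> j"
  shows "transpose_mat (elem_mat n i j (r::'a::ring_1)) = elem_mat n j i r"
  by (rule square_mat_eqI[of _ n]) (use assms in auto)

lemma inverse_transpose_elem_mat:
  fixes r :: "'a::ring_1"
  assumes "i \<le> n" "j \<le> n" "i \<noteq> j"
  shows "inverse_transpose n (elem_mat n i j r) = elem_mat n j i (- r)"
  using elem_mat_in_EL[OF assms, of r]
  by (simp only: inverse_transpose_def restrict_apply if_True EL_inv_elem_mat[OF assms]
      transpose_elem_mat[OF assms])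

text \<open>Inversion and transposition each reverse the order of a product, so together they keep
  it; for transposition this relies on commuting ring elements. On generators the map is undone by
  swapping the indices and the sign again.\<close>

lemma inverse_transpose_in_auto:
  "inverse_transpose n \<in> auto (EL_group n :: 'a::comm_ring_1 mat monoid)"
proof (rule EL_autoI)
  interpret group "EL_group n :: 'a mat monoid" by (rule group_EL)
  let ?C = "carrier (EL_group n) :: 'a mat set"
  show "inverse_transpose n \<in> extensional ?C"
    by (simp add: inverse_transpose_def)
  show "inj_on (inverse_transpose n) ?C"
    by (auto simp: inj_on_def inverse_transpose_def transpose_mat_eq)
  show "inverse_transpose n (A * B) = inverse_transpose n A * inverse_transpose n B"
    if AB: "A \<in> ?C" "B \<in> ?C" for A B
  proof -
    have "inv\<^bsub>EL_group n\<^esub> (A * B) = inv\<^bsub>EL_group n\<^esub> B * inv\<^bsub>EL_group n\<^esub> A"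
      using inv_mult_group[OF AB] by (simp only: EL_simps)
    then show ?thesis
      using AB EL_mult_closed[OF AB]
        transpose_mult[OF EL_carrier_mat[OF inv_closed[OF AB(2)]] EL_carrier_mat[OF inv_closed[OF AB(1)]]]
      by (simp add: inverse_transpose_def)
  qed
  show "inverse_transpose n (1\<^sub>m (n + 1)) = (1\<^sub>m (n + 1) :: 'a mat)"
    using inv_one one_closed by (simp only: EL_simps inverse_transpose_def) simp
  show "inverse_transpose n (elem_mat n i j r) \<in> ?C"
    if "i \<le> n" "j \<le> n" "i \<noteq> j" for i j and r :: 'a
    unfolding inverse_transpose_elem_mat[OF that] using that by (intro elem_mat_in_EL) auto
  show "elem_mat n i j r \<in> inverse_transpose n ` ?C"
    if "i \<le> n" "j \<le> n" "i \<noteq> j" for i j and r :: 'a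
    by (rule image_eqI[of _ _ "elem_mat n j i (- r)"])
      (use that inverse_transpose_elem_mat[of j n i "- r"] elem_mat_in_EL in auto)
qed

section \<open>Rotation and reversal of the indices, and the automorphisms built from them\<close>

lemma bij_betw_rho_cyc: "bij_betw (rho_cyc n) {0..n} {0..n}"
\<comment> \<open>Modulo \<open>n + 1\<close>, adding \<open>n\<close> is subtracting 1, so the
  witness is the backward rotation.\<close>
proof (rule bij_betw_byWitness[where f' = "\<lambda>i. (i + n) mod (n + 1)"])
  have "(i + 1 + n) mod (n + 1) = i" if "i \<in> {0..n}" for i
    using that mod_add_self2[of i "n + 1"] by (simp add: ac_simps)
  then show "\<forall>i\<in>{0..n}. (rho_cyc n i + n) mod (n + 1) = i"
    "\<forall>i\<in>{0..n}. rho_cyc n ((i + n) mod (n + 1)) = i"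
    by (simp_all add: rho_cyc_def mod_simps)
qed (auto simp: rho_cyc_def less_Suc_eq_le[symmetric])

lemma bij_betw_rho_rev: "bij_betw (rho_rev n) {0..n} {0..n}"
  by (rule bij_betw_byWitness[where f' = "rho_rev n"])
    (auto simp: rho_rev_def)

lemma gamma_r_in_auto: "gamma_r n \<in> auto (EL_group n :: 'a::ring_1 mat monoid)"
  unfolding gamma_r_def by (rule perm_aut_in_auto[OF bij_betw_rho_cyc])

text \<open>Multiplication in \<open>AutoGroup\<close> is \<open>compose\<close> on the carrier, so
  \<open>gamma_s n\<close> is literally a product of two automorphisms.\<close>

lemma gamma_s_in_auto: "gamma_s n \<in> auto (EL_group n :: 'a::comm_ring_1 mat monoid)"
proof -
  interpret group "EL_group n :: 'a mat monoid" by (rule group_EL)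
  have "inverse_transpose n \<otimes>\<^bsub>AutoGroup (EL_group n)\<^esub> perm_aut n (rho_rev n)
      \<in> carrier (AutoGroup (EL_group n :: 'a mat monoid))"
    using monoid.m_closed[OF group.is_monoid[OF AutoGroup]]
      inverse_transpose_in_auto[where 'a = 'a] perm_aut_in_auto[OF bij_betw_rho_rev, where 'a = 'a]
    by (simp add: AutoGroup_def)
  then show ?thesis
    using inverse_transpose_in_auto[where 'a = 'a] perm_aut_in_auto[OF bij_betw_rho_rev, where 'a = 'a]
    by (simp add: AutoGroup_def BijGroup_def auto_def gamma_s_def)
qed

section \<open>The action on the subgroup geometry system\<close>

lemma rho_cyc_le: "rho_cyc n i \<le> n"
  by (simp add: rho_cyc_def less_Suc_eq_le[symmetric])

lemma rho_rev_le: "rho_rev n i \<le> n"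
  by (simp add: rho_rev_def less_Suc_eq_le[symmetric])

text \<open>It fails for \<open>n = 0\<close>, where the cycle has a single vertex. It keeps the
  generators of the groups \<open>K_subgroup n T i\<close> off the diagonal, hence
  elementary.\<close>

lemma rho_cyc_neq: "n \<ge> 1 \<Longrightarrow> i \<le> n \<Longrightarrow> rho_cyc n i \<noteq> i"
  by (cases "i = n") (auto simp: rho_cyc_def)

lemma rho_cyc_eq_iff: "i \<le> n \<Longrightarrow> j \<le> n \<Longrightarrow> rho_cyc n i = rho_cyc n j \<longleftrightarrow> i = j"
  using bij_betw_imp_inj_on[OF bij_betw_rho_cyc] by (auto simp: inj_on_def)

text \<open>With the generators written as the image of a product set, the effect of an automorphism
  can be computed on positions and coefficients separately.\<close>

lemma K_subgroup_altdef:
  "K_subgroup n (T::'a::ring_1 set) i =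
    generate (EL_group n) ((\<lambda>(j, m). elem_mat n j (rho_cyc n j) m) ` (({0..n} - {i}) \<times> T))"
proof -
  have "(\<lambda>(j, m). f j m) ` (A \<times> B) = {f j m | j m. j \<in> A \<and> m \<in> B}"
    for f :: "nat \<Rightarrow> 'a \<Rightarrow> 'a mat" and A B by auto
  then show ?thesis unfolding K_subgroup_def rho_cyc_def by (simp only:)
qed

lemma K_subgroup_generators_in_EL:
  assumes "n \<ge> 1"
  shows "(\<lambda>(j, m). elem_mat n j (rho_cyc n j) m) ` (({0..n} - {i}) \<times> T)
    \<subseteq> carrier (EL_group n :: 'a::ring_1 mat monoid)"
proof -
  have "elem_mat n j (rho_cyc n j) m \<in> carrier (EL_group n)" if "j \<le> n" for j and m :: 'a
    using that rho_cyc_le rho_cyc_neq[OF assms, of j] by (intro elem_mat_in_EL) auto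
  then show ?thesis by auto
qed

lemma K_subgroup_subset:
  assumes "n \<ge> 1"
  shows "K_subgroup n T i \<subseteq> carrier (EL_group n :: 'a::ring_1 mat monoid)"
  unfolding K_subgroup_altdef
  by (intro group.generate_incl[OF group_EL] K_subgroup_generators_in_EL assms)

text \<open>Criterion shared by both generators of \<open>Gamma n\<close>. If positions move by a
  bijection \<open>\<pi>\<close> and coefficients by a surjection of \<open>T\<close> onto itself,
  then the generators missing position i go onto those missing \<open>\<pi> i\<close>, and a
  homomorphism commutes with generation.\<close>

lemma auto_image_K_subgroup:
  fixes \<gamma> :: "'a::ring_1 mat \<Rightarrow> 'a mat"
  assumes n: "n \<ge> 1" and \<gamma>: "\<gamma> \<in> auto (EL_group n)"
    and \<pi>: "bij_betw \<pi> {0..n} {0..n}" and \<phi>: "\<phi> ` T = T" and i: "i \<le> n"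
    and elem: "\<And>j m. j \<le> n \<Longrightarrow> m \<in> T \<Longrightarrow>
      \<gamma> (elem_mat n j (rho_cyc n j) m) = elem_mat n (\<pi> j) (rho_cyc n (\<pi> j)) (\<phi> m)"
  shows "\<gamma> ` K_subgroup n T i = K_subgroup n T (\<pi> i)"
proof -
  let ?e = "\<lambda>(j, m :: 'a). elem_mat n j (rho_cyc n j) m"
  interpret group_hom "EL_group n :: 'a mat monoid" "EL_group n :: 'a mat monoid" \<gamma>
    using \<gamma> group_EL by (simp add: group_hom_def group_hom_axioms_def auto_def)
  have "\<gamma> ` ?e ` (({0..n} - {i}) \<times> T) = ?e ` map_prod \<pi> \<phi> ` (({0..n} - {i}) \<times> T)"
    unfolding image_image by (intro image_cong) (auto simp: elem[simplified])
  also have "map_prod \<pi> \<phi> ` (({0..n} - {i}) \<times> T) = (\<pi> ` ({0..n} - {i})) \<times> T"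
    using \<phi> by (rule map_prod_surj_on[OF refl])
  also have "\<pi> ` ({0..n} - {i}) = {0..n} - {\<pi> i}"
    using \<pi> i by (subst inj_on_image_set_diff[of _ "{0..n}"]) (auto simp: bij_betw_def)
  finally have gens: "\<gamma> ` ?e ` (({0..n} - {i}) \<times> T) = ?e ` (({0..n} - {\<pi> i}) \<times> T)" .
  show ?thesis
    unfolding K_subgroup_altdef generate_img[OF K_subgroup_generators_in_EL[OF n], symmetric] gens ..
qed

lemma gamma_r_K_subgroup:
  fixes T :: "'a::ring_1 set"
  assumes n: "n \<ge> 1" and i: "i \<le> n"
  shows "gamma_r n ` K_subgroup n T i = K_subgroup n T (rho_cyc n i)"
proof (rule auto_image_K_subgroup[OF n gamma_r_in_auto bij_betw_rho_cyc image_ident i])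
  fix j and m :: 'a assume "j \<le> n"
  then show "gamma_r n (elem_mat n j (rho_cyc n j) m) =
      elem_mat n (rho_cyc n j) (rho_cyc n (rho_cyc n j)) m"
    unfolding gamma_r_def
    by (intro perm_aut_elem_mat[OF bij_betw_rho_cyc _ rho_cyc_le] rho_cyc_neq[OF n, symmetric])
qed

text \<open>Reversal turns a forward step into a backward one, which the outer forward step undoes.
  At \<open>i = n\<close> the inner step wraps to 0, reversal gives \<open>n\<close>, and the outer
  step wraps to 0 again.\<close>

lemma rho_cyc_rev_cyc: "i \<le> n \<Longrightarrow> rho_cyc n (rho_rev n (rho_cyc n i)) = rho_rev n i"
proof (cases "i = n")
  case False
  assume "i \<le> n"
  with False have "rho_cyc n i = i + 1" "rho_cyc n (n - (i + 1)) = n - i"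
    by (simp_all add: rho_cyc_def)
  then show ?thesis by (simp add: rho_rev_def)
qed (simp add: rho_cyc_def rho_rev_def)

lemma bij_betw_rev_cyc: "bij_betw (rho_rev n \<circ> rho_cyc n) {0..n} {0..n}"
  by (rule bij_betw_trans[OF bij_betw_rho_cyc bij_betw_rho_rev])

text \<open>Reversal alone yields a matrix whose indices run backwards along the cycle, and the
  transpose swaps them. The new first index is therefore the reversal of the successor of j, which
  explains \<open>rho_rev n \<circ> rho_cyc n\<close> in place of \<open>rho_rev n\<close>.\<close>

lemma gamma_s_K_subgroup:
  fixes T :: "'a::comm_ring_1 set"
  assumes n: "n \<ge> 1" and i: "i \<le> n" and T: "uminus ` T = T"
  shows "gamma_s n ` K_subgroup n T i = K_subgroup n T ((rho_rev n \<circ> rho_cyc n) i)"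
proof (rule auto_image_K_subgroup[OF n gamma_s_in_auto bij_betw_rev_cyc T i])
  fix j and m :: 'a assume j: "j \<le> n"
  have ne: "j \<noteq> rho_cyc n j" using rho_cyc_neq[OF n j] by simp
  have ne': "rho_rev n j \<noteq> rho_rev n (rho_cyc n j)"
    using bij_betw_imp_inj_on[OF bij_betw_rho_rev] ne j rho_cyc_le by (auto simp: inj_on_def)
  have "gamma_s n (elem_mat n j (rho_cyc n j) m) =
      inverse_transpose n (perm_aut n (rho_rev n) (elem_mat n j (rho_cyc n j) m))"
    using elem_mat_in_EL[OF j rho_cyc_le ne, of m] by (simp add: gamma_s_def compose_def)
  also have "\<dots> = elem_mat n (rho_rev n (rho_cyc n j)) (rho_rev n j) (- m)"
    by (simp only: perm_aut_elem_mat[OF bij_betw_rho_rev j rho_cyc_le ne]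
        inverse_transpose_elem_mat[OF rho_rev_le rho_rev_le ne'])
  finally show "gamma_s n (elem_mat n j (rho_cyc n j) m) = elem_mat n ((rho_rev n \<circ> rho_cyc n) j)
      (rho_cyc n ((rho_rev n \<circ> rho_cyc n) j)) (- m)"
    by (simp only: o_apply rho_cyc_rev_cyc[OF j])
qed

text \<open>Left multiplication by the generators of \<open>K_subgroup n T i\<close> never changes row \<open>i\<close>.\<close>

lemma K_subgroup_row:
  fixes T :: "'a::ring_1 set"
  assumes n: "n \<ge> 1" and i: "i \<le> n" and A: "A \<in> K_subgroup n T i" and b: "b \<le> n"
  shows "A $$ (i, b) = (if i = b then 1 else 0)"
proof -
  let ?G = "(\<lambda>(j, m). elem_mat n j (rho_cyc n j) m) ` (({0..n} - {i}) \<times> T)"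
  have sub: "generate (EL_group n) ?G \<subseteq> carrier (EL_group n)"
    by (intro group.generate_incl[OF group_EL] K_subgroup_generators_in_EL n)
  have "A \<in> generate (EL_group n) ?G" using A by (simp only: K_subgroup_altdef)
  then have "\<forall>b\<le>n. A $$ (i, b) = (if i = b then 1 else 0)"
  proof (induction rule: generate.induct)
    case one
    then show ?case using i by (auto simp: EL_simps)
  next
    case (incl h)
    then show ?case using i by auto
  next
    case (inv h)
    then obtain p where p: "p \<in> ({0..n} - {i}) \<times> T" "h = (case p of (j, m) \<Rightarrow> elem_mat n j (rho_cyc n j) m)"
      by blast
    define j where "j = fst p"
    define m where "m = snd p"
    have j: "j \<le> n" "j \<noteq> i" and h: "h = elem_mat n j (rho_cyc n j) m"
      using p by (auto simp: j_def m_def)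
    \<comment> \<open>The inverse again has its off-diagonal entry in row \<open>j\<close>, which
      differs from row \<open>i\<close>.\<close>
    have "inv\<^bsub>EL_group n\<^esub> h = elem_mat n j (rho_cyc n j) (- m)"
      unfolding h using rho_cyc_neq[OF n j(1)] by (intro EL_inv_elem_mat j rho_cyc_le) simp
    then show ?case using j i by simp
  next
    case (eng h1 h2)
    then have h: "h1 \<in> carrier (EL_group n)" "h2 \<in> carrier (EL_group n)" using sub by auto
    show ?case
    proof (intro allI impI)
      fix b assume b: "b \<le> n"
      have "(h1 * h2) $$ (i, b) = (\<Sum>k\<in>{0..n}. h1 $$ (i, k) * h2 $$ (k, b))"
        by (rule EL_mult_index[OF h i b])
      \<comment> \<open>Row \<open>i\<close> of \<open>h1\<close> is a unit vector, so the sum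
        collapses to row \<open>i\<close> of \<open>h2\<close>.\<close>
      also have "\<dots> = (\<Sum>k\<in>{0..n}. if i = k then h2 $$ (k, b) else 0)"
        using eng.IH(1) by (intro sum.cong) auto
      also have "\<dots> = h2 $$ (i, b)" using i by simp
      finally show "(h1 \<otimes>\<^bsub>EL_group n\<^esub> h2) $$ (i, b) = (if i = b then 1 else 0)"
        using eng.IH(2) b by (simp add: EL_simps)
    qed
  qed
  then show ?thesis using b by blast
qed

lemma K_subgroup_inj:
  fixes T :: "'a::ring_1 set"
  assumes n: "n \<ge> 1" and T: "1 \<in> T" and ik: "i \<le> n" "k \<le> n"
    and eq: "K_subgroup n T i = K_subgroup n T k"
  shows "i = k"
proof (rule ccontr)
  assume "i \<noteq> k"
  then have "elem_mat n i (rho_cyc n i) 1 \<in> K_subgroup n T k"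
    unfolding K_subgroup_altdef using ik T by (intro generate.incl) auto
  \<comment> \<open>At (\<open>i\<close>, \<open>rho_cyc n i\<close>) this matrix has entry 1,
    whereas row \<open>i\<close> in \<open>K_subgroup n T i\<close> has 0 off the diagonal.\<close>
  from K_subgroup_row[OF n ik(1) this[folded eq] rho_cyc_le[of n i]]
  show False using ik rho_cyc_le[of n i] rho_cyc_neq[OF n ik(1)]
    by (auto simp: less_Suc_eq_le)
qed

section \<open>The dihedral group\<close>

text \<open>Replaces integer congruences by the successor map: residues in \<open>{0..n}\<close> are
  unique representatives, so a congruence to a successor is an equality.\<close>

lemma cyc_adjacent_iff:
  assumes "i \<le> n" "j \<le> n"
  shows "cyc_adjacent n i j \<longleftrightarrow> i = rho_cyc n j \<or> j = rho_cyc n i"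
proof -
  have *: "[int a - int b = 1] (mod int (n + 1)) \<longleftrightarrow> a = rho_cyc n b" if "a \<le> n" for a b
  proof -
    have "[int a - int b = 1] (mod int (n + 1)) \<longleftrightarrow> [int a = int (b + 1)] (mod int (n + 1))"
      by (simp add: cong_iff_dvd_diff algebra_simps)
    also have "\<dots> \<longleftrightarrow> [a = b + 1] (mod (n + 1))"
      by (rule cong_int_iff)
    also have "\<dots> \<longleftrightarrow> a = rho_cyc n b"
      using that by (simp add: cong_def rho_cyc_def)
    finally show ?thesis .
  qed
  \<comment> \<open>Negating both sides exchanges \<open>i\<close> and \<open>j\<close> and reduces
    this case to the previous one.\<close>
  have "[int i - int j = - 1] (mod int (n + 1)) \<longleftrightarrow> [int j - int i = 1] (mod int (n + 1))"
    using cong_minus_minus_iff[of "int i - int j" "- 1" "int (n + 1)"] by simp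
  then show ?thesis using * assms by (simp add: cyc_adjacent_def)
qed

lemma dihedral_iff:
  "\<psi> \<in> dihedral n \<longleftrightarrow> \<psi> permutes {0..n} \<and>
    (\<forall>i\<le>n. \<forall>j\<le>n. cyc_adjacent n i j \<longleftrightarrow> cyc_adjacent n (\<psi> i) (\<psi> j))"
  by (auto simp: dihedral_def)

lemma permutes_le: "\<psi> permutes {0..n} \<Longrightarrow> i \<le> n \<Longrightarrow> \<psi> i \<le> (n::nat)"
  using permutes_in_image[of \<psi> "{0..n}" i] by simp

lemma dihedral_id: "id \<in> dihedral n"
  by (simp add: dihedral_def permutes_id)

lemma dihedral_comp:
  assumes \<psi>: "\<psi> \<in> dihedral n" and \<psi>': "\<psi>' \<in> dihedral n"
  shows "\<psi> \<circ> \<psi>' \<in> dihedral n"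
proof -
  have perm: "\<psi> permutes {0..n}" "\<psi>' permutes {0..n}" using assms by (simp_all add: dihedral_iff)
  have "cyc_adjacent n i j \<longleftrightarrow> cyc_adjacent n (\<psi> (\<psi>' i)) (\<psi> (\<psi>' j))" if "i \<le> n" "j \<le> n" for i j
  proof -
    have "cyc_adjacent n i j \<longleftrightarrow> cyc_adjacent n (\<psi>' i) (\<psi>' j)"
      using \<psi>' that unfolding dihedral_iff by blast
    also have "\<dots> \<longleftrightarrow> cyc_adjacent n (\<psi> (\<psi>' i)) (\<psi> (\<psi>' j))"
      using \<psi> permutes_le[OF perm(2)] that unfolding dihedral_iff by blast
    finally show ?thesis .
  qed
  then show ?thesis using permutes_compose[OF perm(2,1)] unfolding dihedral_iff o_apply by blast
qed

lemma dihedral_inv: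
  assumes "\<psi> \<in> dihedral n"
  shows "inv_into UNIV \<psi> \<in> dihedral n"
proof -
  have perm: "\<psi> permutes {0..n}" using assms by (simp add: dihedral_iff)
  then have "cyc_adjacent n (inv_into UNIV \<psi> i) (inv_into UNIV \<psi> j) \<longleftrightarrow> cyc_adjacent n i j"
    if "i \<le> n" "j \<le> n" for i j
    using assms that permutes_le[OF permutes_inv[OF perm]]
    by (simp add: dihedral_iff permutes_inverses(1)[OF perm])
  then show ?thesis using permutes_inv[OF perm] by (simp add: dihedral_iff)
qed

text \<open>\<open>rho_cyc n\<close> and \<open>rho_rev n\<close> move numbers above
  \<open>n\<close>, while members of \<open>dihedral n\<close> must fix them; this repairs the
  values outside the cycle.\<close>

definition extend_perm :: "nat \<Rightarrow> (nat \<Rightarrow> nat) \<Rightarrow> nat \<Rightarrow> nat" where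
  "extend_perm n \<pi> i = (if i \<le> n then \<pi> i else i)"

text \<open>The two alternatives are that \<open>\<pi>\<close> keeps or reverses the direction of
  the cycle. Since \<open>\<pi>\<close> is injective, either one gives adjacency in both directions
  of the equivalence.\<close>

lemma extend_perm_in_dihedral:
  assumes \<pi>: "bij_betw \<pi> {0..n} {0..n}"
    and cyc: "(\<forall>i\<le>n. \<pi> (rho_cyc n i) = rho_cyc n (\<pi> i)) \<or> (\<forall>i\<le>n. rho_cyc n (\<pi> (rho_cyc n i)) = \<pi> i)"
  shows "extend_perm n \<pi> \<in> dihedral n"
proof -
  have "extend_perm n \<pi> permutes {0..n}"
    using \<pi> by (intro bij_imp_permutes) (auto simp: extend_perm_def bij_betw_def inj_on_def image_def)
  moreover have "cyc_adjacent n i j \<longleftrightarrow> cyc_adjacent n (\<pi> i) (\<pi> j)" if ij: "i \<le> n" "j \<le> n" for i j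
  proof -
    have le: "\<pi> k \<le> n" if "k \<le> n" for k using bij_betw_apply[OF \<pi>, of k] that by simp
    have eq: "\<pi> a = \<pi> b \<longleftrightarrow> a = b" if "a \<le> n" "b \<le> n" for a b
      using bij_betw_imp_inj_on[OF \<pi>] that by (auto simp: inj_on_def)
    from cyc show ?thesis
    proof
      assume "\<forall>i\<le>n. \<pi> (rho_cyc n i) = rho_cyc n (\<pi> i)"
      then have "i = rho_cyc n j \<longleftrightarrow> \<pi> i = rho_cyc n (\<pi> j)" "j = rho_cyc n i \<longleftrightarrow> \<pi> j = rho_cyc n (\<pi> i)"
        using ij eq[OF ij(1) rho_cyc_le, of j] eq[OF ij(2) rho_cyc_le, of i] by auto
      then show ?thesis using cyc_adjacent_iff ij le by blast
    next
      assume "\<forall>i\<le>n. rho_cyc n (\<pi> (rho_cyc n i)) = \<pi> i"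
      \<comment> \<open>Write \<open>\<pi> j\<close> as
        \<open>rho_cyc n (\<pi> (rho_cyc n j))\<close> and cancel the outer rotation; successor and
        predecessor change places.\<close>
      then have "\<pi> j = rho_cyc n (\<pi> i) \<longleftrightarrow> \<pi> (rho_cyc n j) = \<pi> i"
        "\<pi> i = rho_cyc n (\<pi> j) \<longleftrightarrow> \<pi> (rho_cyc n i) = \<pi> j"
        using ij le rho_cyc_le rho_cyc_eq_iff[OF le[OF rho_cyc_le, of j] le[OF ij(1)]]
          rho_cyc_eq_iff[OF le[OF rho_cyc_le, of i] le[OF ij(2)]] by auto
      then have "i = rho_cyc n j \<longleftrightarrow> \<pi> j = rho_cyc n (\<pi> i)" "j = rho_cyc n i \<longleftrightarrow> \<pi> i = rho_cyc n (\<pi> j)"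
        using ij eq[OF rho_cyc_le, of i j] eq[OF rho_cyc_le, of j i] by auto
      then show ?thesis using cyc_adjacent_iff ij le by blast
    qed
  qed
  ultimately show ?thesis by (simp add: dihedral_iff extend_perm_def)
qed

text \<open>Each step i to i + 1 is mapped to a step forward or backward. Two consecutive steps of
  opposite direction would give \<open>\<psi> (i + 2) = \<psi> i\<close>, so the first step fixes
  the direction of all others.\<close>

lemma dihedral_cases:
  assumes n: "n \<ge> 2" and \<psi>: "\<psi> \<in> dihedral n"
  shows "(\<forall>i<n. \<psi> (i + 1) = rho_cyc n (\<psi> i)) \<or> (\<forall>i<n. \<psi> i = rho_cyc n (\<psi> (i + 1)))"
proof -
  have perm: "\<psi> permutes {0..n}" using \<psi> by (simp add: dihedral_iff)
  have le: "\<psi> i \<le> n" if "i \<le> n" for i using permutes_le[OF perm that] .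
  have adj: "\<psi> (i + 1) = rho_cyc n (\<psi> i) \<or> \<psi> i = rho_cyc n (\<psi> (i + 1))" if "i < n" for i
  proof -
    have "cyc_adjacent n i (i + 1)" using that by (subst cyc_adjacent_iff) (auto simp: rho_cyc_def)
    then show ?thesis using that \<psi> le cyc_adjacent_iff[of "\<psi> i" n "\<psi> (i + 1)"]
      by (auto simp: dihedral_iff)
  qed
  have inj: "\<psi> (i + 2) \<noteq> \<psi> i" for i by (simp add: inj_eq[OF permutes_inj[OF perm]])
  show ?thesis
  proof (rule disjE[OF adj[of 0]])
    show "0 < n" using n by simp
  next
    assume base: "\<psi> (0 + 1) = rho_cyc n (\<psi> 0)"
    have "\<psi> (i + 1) = rho_cyc n (\<psi> i)" if "i < n" for i
      using that
    proof (induction i)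
      case 0
      then show ?case using base by simp
    next
      \<comment> \<open>A backward step would make \<open>\<psi> (i + 2)\<close> and
        \<open>\<psi> i\<close> have the same successor, namely
        \<open>\<psi> (i + 1)\<close>.\<close>
      case (Suc i)
      then show ?case
        using adj[of "Suc i"] inj[of i] rho_cyc_eq_iff[of "\<psi> (i + 2)" n "\<psi> i"] le[of "i + 2"] le[of i]
        by auto
    qed
    then show ?thesis by blast
  next
    assume base: "\<psi> 0 = rho_cyc n (\<psi> (0 + 1))"
    have "\<psi> i = rho_cyc n (\<psi> (i + 1))" if "i < n" for i
      using that
    proof (induction i)
      case 0
      then show ?case using base by simp
    next
      \<comment> \<open>A forward step would make \<open>\<psi> (i + 2)\<close> the successor of
        \<open>\<psi> (i + 1)\<close>, which is \<open>\<psi> i\<close>.\<close>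
      case (Suc i)
      then show ?case
        using adj[of "Suc i"] inj[of i] by auto
    qed
    then show ?thesis by blast
  qed
qed

section \<open>Normal forms of dihedral permutations\<close>

lemma rho_cyc_funpow: "i \<le> n \<Longrightarrow> (rho_cyc n ^^ k) i = (i + k) mod (n + 1)"
  by (induction k) (auto simp: rho_cyc_def mod_simps)

lemma rho_cyc_transitive:
  assumes "a \<le> n" "b \<le> n"
  obtains k where "(rho_cyc n ^^ k) a = b"
proof
  \<comment> \<open>The exponent takes \<open>a\<close> to 0 in \<open>n + 1 - a\<close> steps and
    then on to \<open>b\<close>, so no natural subtraction is cut off at 0.\<close>
  have *: "a + (n + 1 - a + b) = b + (n + 1)" using assms by simp
  then show "(rho_cyc n ^^ (n + 1 - a + b)) a = b"
    unfolding rho_cyc_funpow[OF assms(1)] * mod_add_self2 using assms by simp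
qed

text \<open>The power is chosen so that both sides agree at 0. Both obey the same one-step recursion
  along 0, ..., n, because powers of the rotation commute with it, and hence they agree
  throughout.\<close>

lemma dihedral_generated:
  assumes n: "n \<ge> 2" and \<psi>: "\<psi> \<in> dihedral n"
  shows "\<exists>k. (\<forall>i\<le>n. \<psi> i = (rho_cyc n ^^ k) i) \<or>
    (\<forall>i\<le>n. \<psi> i = (rho_cyc n ^^ k) ((rho_rev n \<circ> rho_cyc n) i))"
proof -
  have perm: "\<psi> permutes {0..n}" using \<psi> by (simp add: dihedral_iff)
  have le: "\<psi> i \<le> n" if "i \<le> n" for i using permutes_le[OF perm that] .
  have comm: "(rho_cyc n ^^ k) (rho_cyc n a) = rho_cyc n ((rho_cyc n ^^ k) a)" for k a
    using funpow_swap1[of "rho_cyc n" k a] by simp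
  from dihedral_cases[OF assms] show ?thesis
  proof
    assume step: "\<forall>i<n. \<psi> (i + 1) = rho_cyc n (\<psi> i)"
    obtain k where k: "(rho_cyc n ^^ k) 0 = \<psi> 0" using rho_cyc_transitive[of 0 n "\<psi> 0"] le by auto
    have "\<psi> i = (rho_cyc n ^^ k) i" if "i \<le> n" for i
      using that
    proof (induction i)
      case (Suc i)
      then have "rho_cyc n i = Suc i" by (simp add: rho_cyc_def)
      then show ?case using Suc step comm[of k i] by simp
    qed (use k in simp)
    then show ?thesis by blast
  next
    let ?\<sigma> = "rho_rev n \<circ> rho_cyc n"
    assume step: "\<forall>i<n. \<psi> i = rho_cyc n (\<psi> (i + 1))"
    obtain k where k: "(rho_cyc n ^^ k) (?\<sigma> 0) = \<psi> 0"
      using rho_cyc_transitive[of "?\<sigma> 0" n "\<psi> 0"] le rho_rev_le by auto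
    have "\<psi> i = (rho_cyc n ^^ k) (?\<sigma> i)" if "i \<le> n" for i
      using that
    proof (induction i)
      case (Suc i)
      have c: "rho_cyc n i = Suc i" using Suc.prems by (simp add: rho_cyc_def)
      have "?\<sigma> i = rho_cyc n (?\<sigma> (Suc i))"
        using rho_cyc_rev_cyc[OF rho_cyc_le, of n i] c by simp
      \<comment> \<open>The backward recursion determines the next value only under
        \<open>rho_cyc n\<close>; cancelling that needs both arguments to lie in
        \<open>{0..n}\<close>.\<close>
      then have "rho_cyc n (\<psi> (Suc i)) = rho_cyc n ((rho_cyc n ^^ k) (?\<sigma> (Suc i)))"
        using Suc step comm by auto
      moreover have "(rho_cyc n ^^ k) (?\<sigma> (Suc i)) \<le> n"
        using rho_rev_le by (simp add: rho_cyc_funpow less_Suc_eq_le[symmetric])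
      ultimately show ?case using rho_cyc_eq_iff le[OF Suc.prems] by blast
    qed (use k in simp)
    then show ?thesis by blast
  qed
qed

section \<open>The image of \<open>Psi\<close>\<close>

text \<open>Uniqueness for the description operator: distinct indices give distinct groups, which
  settles the values up to \<open>n\<close>, and permutations of \<open>{0..n}\<close> fix
  everything above.\<close>

lemma Psi_eqI:
  fixes T :: "'a::ring_1 set"
  assumes n: "n \<ge> 1" and T: "1 \<in> T" and \<psi>: "\<psi> permutes {0..n}"
    and K: "\<And>i. i \<le> n \<Longrightarrow> \<gamma> ` K_subgroup n T i = K_subgroup n T (\<psi> i)"
  shows "Psi n T \<gamma> = \<psi>"
  unfolding Psi_def
proof (rule the_equality)
  show "\<psi> permutes {0..n} \<and> (\<forall>i\<in>{0..n}. \<gamma> ` K_subgroup n T i = K_subgroup n T (\<psi> i))"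
    using \<psi> K by simp
next
  fix \<psi>' assume \<psi>': "\<psi>' permutes {0..n} \<and> (\<forall>i\<in>{0..n}. \<gamma> ` K_subgroup n T i = K_subgroup n T (\<psi>' i))"
  show "\<psi>' = \<psi>"
  proof
    fix i
    show "\<psi>' i = \<psi> i"
    proof (cases "i \<le> n")
      case True
      then show ?thesis
        using K_subgroup_inj[OF n T, of "\<psi>' i" "\<psi> i"] \<psi> \<psi>' K permutes_le by auto
    next
      case False
      then show ?thesis using \<psi> \<psi>' by (auto simp: permutes_def)
    qed
  qed
qed

lemma preserves_systemI:
  assumes \<psi>: "\<psi> permutes {0..n}"
    and K: "\<And>i. i \<le> n \<Longrightarrow> \<gamma> ` K_subgroup n T i = K_subgroup n T (\<psi> i)"
  shows "preserves_system n T \<gamma>"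
proof -
  have "{\<gamma> ` K_subgroup n T i | i. i \<in> {0..n}} = (\<lambda>i. \<gamma> ` K_subgroup n T i) ` {0..n}"
    by blast
  also have "\<dots> = K_subgroup n T ` \<psi> ` {0..n}"
    unfolding image_image by (rule image_cong) (simp_all add: K)
  also have "\<dots> = {K_subgroup n T i | i. i \<in> {0..n}}"
    using permutes_image[OF \<psi>] by auto
  finally show ?thesis by (simp add: preserves_system_def)
qed

section \<open>Composition and inverses in \<open>Gamma\<close>\<close>

lemma AutoGroup_EL_mult:
  "\<lbrakk>\<gamma> \<in> auto (EL_group n); \<gamma>' \<in> auto (EL_group n)\<rbrakk> \<Longrightarrow>
    \<gamma> \<otimes>\<^bsub>AutoGroup (EL_group n)\<^esub> \<gamma>' = compose (carrier (EL_group n)) \<gamma> (\<gamma>' :: 'a::ring_1 mat \<Rightarrow> _)"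
  by (simp add: AutoGroup_def BijGroup_def auto_def)

lemma compose_image: "B \<subseteq> A \<Longrightarrow> compose A f g ` B = f ` g ` B"
  by (auto simp: compose_def image_iff subset_iff)

lemma restrict_id_image: "B \<subseteq> A \<Longrightarrow> (\<lambda>x\<in>A. x) ` B = B"
  by (simp add: subset_iff)

lemma Gamma_subgroup: "subgroup (Gamma n) (AutoGroup (EL_group n :: 'a::comm_ring_1 mat monoid))"
  unfolding Gamma_def
  by (rule group.generate_is_subgroup[OF group.AutoGroup[OF group_EL]])
    (simp add: AutoGroup_def gamma_r_in_auto gamma_s_in_auto)

lemma Gamma_subset_auto: "Gamma n \<subseteq> auto (EL_group n :: 'a::comm_ring_1 mat monoid)"
  using subgroup.subset[OF Gamma_subgroup] by (simp add: AutoGroup_def)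

lemma Gamma_compose:
  fixes \<gamma> :: "'a::comm_ring_1 mat \<Rightarrow> 'a mat"
  assumes "\<gamma> \<in> Gamma n" "\<gamma>' \<in> Gamma n"
  shows "compose (carrier (EL_group n)) \<gamma> \<gamma>' \<in> Gamma n"
  using subgroup.m_closed[OF Gamma_subgroup assms] assms Gamma_subset_auto AutoGroup_EL_mult
  by (metis subsetD)

text \<open>The product of \<gamma> with its inverse is the unit of \<open>AutoGroup\<close>, the
  identity restricted to the carrier, and this leaves every subset of the carrier in place.\<close>

lemma AutoGroup_EL_inv_image:
  fixes \<gamma> :: "'a::ring_1 mat \<Rightarrow> 'a mat"
  assumes \<gamma>: "\<gamma> \<in> auto (EL_group n)" and B: "B \<subseteq> carrier (EL_group n)"
  shows "(inv\<^bsub>AutoGroup (EL_group n)\<^esub> \<gamma>) ` \<gamma> ` B = B"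
proof -
  interpret group "AutoGroup (EL_group n :: 'a mat monoid)"
    by (rule group.AutoGroup[OF group_EL])
  have c: "\<gamma> \<in> carrier (AutoGroup (EL_group n))" using \<gamma> by (simp add: AutoGroup_def)
  then have "inv\<^bsub>AutoGroup (EL_group n)\<^esub> \<gamma> \<in> auto (EL_group n)"
    using inv_closed[OF c] by (simp add: AutoGroup_def)
  then have "compose (carrier (EL_group n)) (inv\<^bsub>AutoGroup (EL_group n)\<^esub> \<gamma>) \<gamma>
      = (\<lambda>x\<in>carrier (EL_group n). x)"
    using l_inv[OF c] AutoGroup_EL_mult[OF _ \<gamma>] by (simp add: AutoGroup_def BijGroup_def)
  then show ?thesis
    using compose_image[OF B, of "inv\<^bsub>AutoGroup (EL_group n)\<^esub> \<gamma>" \<gamma>] restrict_id_image[OF B] by simp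
qed

text \<open>Both generators induce dihedral permutations, and \<open>dihedral n\<close> is closed
  under composition and inverses, so induction over \<open>generate\<close> covers all of
  \<open>Gamma n\<close>.\<close>

lemma Gamma_induces_dihedral:
  fixes T :: "'a::comm_ring_1 set"
  assumes n: "n \<ge> 1" and T: "uminus ` T = T" and "\<gamma> \<in> Gamma n"
  shows "\<exists>\<psi>\<in>dihedral n. \<forall>i\<le>n. \<gamma> ` K_subgroup n T i = K_subgroup n T (\<psi> i)"
proof -
  let ?A = "AutoGroup (EL_group n :: 'a mat monoid)"
  let ?P = "\<lambda>\<gamma>. \<exists>\<psi>\<in>dihedral n. \<forall>i\<le>n. \<gamma> ` K_subgroup n T i = K_subgroup n T (\<psi> i)"
  note sub = K_subgroup_subset[OF n, of T]
  have gen: "h \<in> auto (EL_group n) \<and> ?P h" if "h \<in> {gamma_r n, gamma_s n}" for h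
  proof -
    have "?P (gamma_r n)"
    proof (rule bexI)
      show "extend_perm n (rho_cyc n) \<in> dihedral n"
        by (rule extend_perm_in_dihedral[OF bij_betw_rho_cyc]) simp
    qed (simp add: extend_perm_def gamma_r_K_subgroup[OF n])
    moreover have "?P (gamma_s n)"
    proof (rule bexI)
      show "extend_perm n (rho_rev n \<circ> rho_cyc n) \<in> dihedral n"
        \<comment> \<open>The reflection satisfies the direction-reversing alternative.\<close>
        using rho_cyc_rev_cyc[OF rho_cyc_le] by (intro extend_perm_in_dihedral[OF bij_betw_rev_cyc]) simp
    qed (use gamma_s_K_subgroup[OF n _ T] in \<open>simp add: extend_perm_def\<close>)
    ultimately show ?thesis using that gamma_r_in_auto gamma_s_in_auto by blast
  qed
  have "\<gamma> \<in> generate ?A {gamma_r n, gamma_s n}" using assms(3) by (simp add: Gamma_def)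
  then show ?thesis
  proof (induction rule: generate.induct)
    case one
    have "(\<lambda>x\<in>carrier (EL_group n). x) ` K_subgroup n T i = K_subgroup n T i" for i
      by (rule restrict_id_image[OF sub])
    then show ?case
      by (intro bexI[OF _ dihedral_id]) (simp add: AutoGroup_def BijGroup_def)
  next
    case (incl h)
    then show ?case using gen by blast
  next
    case (inv h)
    then obtain \<psi> where h: "h \<in> auto (EL_group n)" and \<psi>: "\<psi> \<in> dihedral n"
      and K: "\<forall>i\<le>n. h ` K_subgroup n T i = K_subgroup n T (\<psi> i)"
      using gen by blast
    have perm: "\<psi> permutes {0..n}" using \<psi> by (simp add: dihedral_iff)
    have "(inv\<^bsub>?A\<^esub> h) ` K_subgroup n T i = K_subgroup n T (inv_into UNIV \<psi> i)" if "i \<le> n" for i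
    proof -
      \<comment> \<open>Apply \<open>K\<close> at the preimage of \<open>i\<close> under
        \<open>\<psi>\<close>, then cancel \<open>h\<close>.\<close>
      have "inv_into UNIV \<psi> i \<le> n" "\<psi> (inv_into UNIV \<psi> i) = i"
        using permutes_le[OF permutes_inv[OF perm] that] permutes_inverses(1)[OF perm] by auto
      then have "K_subgroup n T i = h ` K_subgroup n T (inv_into UNIV \<psi> i)" using K by metis
      then show ?thesis using AutoGroup_EL_inv_image[OF h sub] by metis
    qed
    then show ?case using dihedral_inv[OF \<psi>] by blast
  next
    case (eng h1 h2)
    then have h: "h1 \<in> auto (EL_group n)" "h2 \<in> auto (EL_group n)"
      using Gamma_subset_auto by (auto simp: Gamma_def)
    from eng.IH obtain \<psi>1 \<psi>2 where \<psi>: "\<psi>1 \<in> dihedral n" "\<psi>2 \<in> dihedral n"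
      and K: "\<forall>i\<le>n. h1 ` K_subgroup n T i = K_subgroup n T (\<psi>1 i)"
        "\<forall>i\<le>n. h2 ` K_subgroup n T i = K_subgroup n T (\<psi>2 i)" by blast
    have "(h1 \<otimes>\<^bsub>?A\<^esub> h2) ` K_subgroup n T i = K_subgroup n T ((\<psi>1 \<circ> \<psi>2) i)" if "i \<le> n" for i
    proof -
      have "\<psi>2 i \<le> n" using permutes_le \<psi>(2) that by (simp add: dihedral_iff)
      then show ?thesis
        using K that by (simp add: AutoGroup_EL_mult[OF h] compose_image[OF sub])
    qed
    then show ?case using dihedral_comp[OF \<psi>] by blast
  qed
qed

text \<open>Composing k times with \<open>gamma_r n\<close> follows the induced map by k rotations.
  The starting points of interest are the identity and \<open>gamma_s n\<close>.\<close>

lemma Gamma_rho_cyc_funpow: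
  fixes T :: "'a::comm_ring_1 set"
  assumes n: "n \<ge> 1" and \<gamma>: "\<gamma> \<in> Gamma n" and \<pi>: "\<And>i. i \<le> n \<Longrightarrow> \<pi> i \<le> n"
    and K: "\<And>i. i \<le> n \<Longrightarrow> \<gamma> ` K_subgroup n T i = K_subgroup n T (\<pi> i)"
  shows "\<exists>\<gamma>\<in>Gamma n. \<forall>i\<le>n. \<gamma> ` K_subgroup n T i = K_subgroup n T ((rho_cyc n ^^ k) (\<pi> i))"
proof (induction k)
  case 0
  then show ?case using \<gamma> K by auto
next
  case (Suc k)
  then obtain \<gamma>' where \<gamma>': "\<gamma>' \<in> Gamma n"
    and K': "\<forall>i\<le>n. \<gamma>' ` K_subgroup n T i = K_subgroup n T ((rho_cyc n ^^ k) (\<pi> i))" by blast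
  have "gamma_r n \<in> Gamma n" by (auto simp: Gamma_def intro: generate.incl)
  moreover have "(rho_cyc n ^^ k) (\<pi> i) \<le> n" if "i \<le> n" for i
    using \<pi>[OF that] by (simp add: rho_cyc_funpow less_Suc_eq_le[symmetric])
  then have "compose (carrier (EL_group n)) (gamma_r n) \<gamma>' ` K_subgroup n T i =
      K_subgroup n T ((rho_cyc n ^^ Suc k) (\<pi> i))" if "i \<le> n" for i
    using K' that by (simp add: compose_image[OF K_subgroup_subset[OF n]] gamma_r_K_subgroup[OF n])
  ultimately show ?case using Gamma_compose \<gamma>' by blast
qed

text \<open>The two normal forms are realised by a power of \<open>gamma_r n\<close>, alone or after
  \<open>gamma_s n\<close>.\<close>

lemma dihedral_induced_by_Gamma:
  fixes T :: "'a::comm_ring_1 set"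
  assumes n: "n \<ge> 2" and T: "uminus ` T = T" and \<psi>: "\<psi> \<in> dihedral n"
  shows "\<exists>\<gamma>\<in>Gamma n. \<forall>i\<le>n. \<gamma> ` K_subgroup n T i = K_subgroup n T (\<psi> i)"
proof -
  have n1: "n \<ge> 1" using n by simp
  have id: "(\<lambda>x\<in>carrier (EL_group n :: 'a mat monoid). x) \<in> Gamma n"
    using subgroup.one_closed[OF Gamma_subgroup[of n, where 'a = 'a]] by (simp add: AutoGroup_def BijGroup_def)
  have id_K: "(\<lambda>x\<in>carrier (EL_group n). x) ` K_subgroup n T i = K_subgroup n T i" for i
    by (rule restrict_id_image[OF K_subgroup_subset[OF n1]])
  have s: "gamma_s n \<in> Gamma n" by (auto simp: Gamma_def intro: generate.incl)
  obtain k where "(\<forall>i\<le>n. \<psi> i = (rho_cyc n ^^ k) i) \<or>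
      (\<forall>i\<le>n. \<psi> i = (rho_cyc n ^^ k) ((rho_rev n \<circ> rho_cyc n) i))"
    using dihedral_generated[OF n \<psi>] by blast
  then show ?thesis
  proof
    assume "\<forall>i\<le>n. \<psi> i = (rho_cyc n ^^ k) i"
    then show ?thesis using Gamma_rho_cyc_funpow[OF n1 id, of "\<lambda>i. i" T k] id_K by auto
  next
    assume "\<forall>i\<le>n. \<psi> i = (rho_cyc n ^^ k) ((rho_rev n \<circ> rho_cyc n) i)"
    then show ?thesis
      using Gamma_rho_cyc_funpow[OF n1 s, of "rho_rev n \<circ> rho_cyc n" T k] gamma_s_K_subgroup[OF n1 _ T] rho_rev_le
      by auto
  qed
qed

section \<open>The coefficient set: it contains 1 and is symmetric\<close>

lemma affine_span_one:
  assumes "assoc_algebra (scale :: 'r::comm_ring_1 \<Rightarrow> 'a::ring_1 \<Rightarrow> 'a)"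
  shows "1 \<in> affine_span scale t l"
proof -
  interpret assoc_algebra scale by (rule assms)
  show ?thesis unfolding affine_span_def
    \<comment> \<open>Constant coefficient 1, all others 0.\<close>
    by (rule CollectI, rule exI[of _ "\<lambda>i. if i = 0 then 1 else 0"]) simp
qed

text \<open>Negating every coefficient negates the sum. The symmetry is wanted because
  \<open>gamma_s n\<close> changes the sign of the entries of generators.\<close>

lemma affine_span_uminus:
  assumes "assoc_algebra (scale :: 'r::comm_ring_1 \<Rightarrow> 'a::ring_1 \<Rightarrow> 'a)"
  shows "uminus ` affine_span scale t l = affine_span scale t l"
proof -
  interpret assoc_algebra scale by (rule assms)
  have closed: "- x \<in> affine_span scale t l" if "x \<in> affine_span scale t l" for x
  proof -
    have "\<exists>r. x = scale (r 0) 1 + (\<Sum>i=1..l. scale (r i) (t i))"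
      using that by (simp add: affine_span_def)
    then obtain r where "x = scale (r 0) 1 + (\<Sum>i=1..l. scale (r i) (t i))"
      by (rule exE)
    then show ?thesis unfolding affine_span_def
      by (intro CollectI exI[of _ "\<lambda>i. - r i"]) (simp add: scale_minus_left sum_negf)
  qed
  \<comment> \<open>Negation is an involution, so closedness under it also gives the reverse
    inclusion.\<close>
  then show ?thesis by (force simp: image_iff intro: minus_minus[symmetric])
qed

theorem theorem3p10:
  fixes scale :: "'r::comm_ring_1 \<Rightarrow> 'a::comm_ring_1 \<Rightarrow> 'a"
    and t :: "nat \<Rightarrow> 'a" and l n :: nat
  assumes "assoc_algebra scale"
    and "algebra_generating_set scale (t ` {1..l})"
    and "n \<ge> 2"
  shows "subgroup (Gamma n) (AutoGroup (EL_group n :: 'a mat monoid))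
    \<and> (\<forall>\<gamma>\<in>Gamma n. preserves_system n (affine_span scale t l) \<gamma>)
    \<and> Psi n (affine_span scale t l) ` Gamma n = dihedral n"
proof (intro conjI)
  let ?T = "affine_span scale t l"
  note one = affine_span_one[OF assms(1), of t l] and uminus = affine_span_uminus[OF assms(1), of t l]
  have n: "n \<ge> 1" using assms(3) by simp
  show "subgroup (Gamma n) (AutoGroup (EL_group n :: 'a mat monoid))"
    by (rule Gamma_subgroup)
  \<comment> \<open>A single dihedral permutation both witnesses preservation of the system and is
    the value of \<open>Psi\<close>.\<close>
  have induced: "preserves_system n ?T \<gamma> \<and> Psi n ?T \<gamma> \<in> dihedral n" if \<gamma>: "\<gamma> \<in> Gamma n" for \<gamma>
  proof -
    obtain \<psi> where "\<psi> \<in> dihedral n" "\<forall>i\<le>n. \<gamma> ` K_subgroup n ?T i = K_subgroup n ?T (\<psi> i)"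
      using Gamma_induces_dihedral[OF n uminus \<gamma>] by blast
    then show ?thesis
      using preserves_systemI[of \<psi> n \<gamma> ?T] Psi_eqI[OF n one, of \<psi> \<gamma>] by (simp add: dihedral_iff)
  qed
  then show "\<forall>\<gamma>\<in>Gamma n. preserves_system n ?T \<gamma>" by blast
  show "Psi n ?T ` Gamma n = dihedral n"
  proof
    show "Psi n ?T ` Gamma n \<subseteq> dihedral n" using induced by blast
    show "dihedral n \<subseteq> Psi n ?T ` Gamma n"
    proof
      fix \<psi> assume \<psi>: "\<psi> \<in> dihedral n"
      then obtain \<gamma> where \<gamma>: "\<gamma> \<in> Gamma n"
        and "\<forall>i\<le>n. \<gamma> ` K_subgroup n ?T i = K_subgroup n ?T (\<psi> i)"
        using dihedral_induced_by_Gamma[OF assms(3) uminus \<psi>] by blast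
      then have "Psi n ?T \<gamma> = \<psi>"
        using Psi_eqI[OF n one, of \<psi> \<gamma>] \<psi> by (simp add: dihedral_iff)
      then show "\<psi> \<in> Psi n ?T ` Gamma n" using \<gamma> by blast
    qed
  qed
qed

end
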